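(* Let $G$ and $H$ be equivalent locally compact Hausdorff groupoids with open range and source maps. Then: (a) $G$ is topologically principal if and only if $H$ is topologically principal. (b) $G$ is essentially principal if and only if $H$ is essentially principal.
   Context: Groupoids are topological groupoids, not assumed second countable and not assumed to have Haar systems. $G^{(0)}$ is the unit space of $G$, and $r,s:G\to G^{(0)}$ are the range and source maps. Actions: a left action of $G$ on a space $P$ consists of a continuous moment map $r_P:P\to G^{(0)}$ and a continuous map $(\gamma,p)\mapsto\gamma\cdot p$ from $G*P=\{(\gamma,p): s(\gamma)=r_P(p)\}$ to $P$ with $r_P(\gamma\cdot p)=r(\gamma)$, $r_P(p)\cdot p=p$ and $\gamma\cdot(\eta\cdot p)=(\gamma\eta)\cdot p$ for composable $\gamma,\eta$. The action is free if $\gamma\cdot p=p$ only when $\gamma=r_P(p)$. It is proper if the map $\Theta:G*P\to P\times P$, $\Theta(\gamma,p)=(\gamma\cdot p,p)$, is proper (preimages of compact sets are compact). Right actions are defined similarly, with moment map $s_P$. Equivalence: $G$ and $H$ are equivalent if there is a $(G,H)$-equivalence, i.e. a locally compact Hausdorff space $Z$ such that: (E1) $Z$ is a free and proper left $G$-space; (E2) $Z$ is a free and proper right $H$-space; (E3) the two actions commute; (E4) the moment map $r_Z:Z\to G^{(0)}$ is open and induces a homeomorphism $Z/H\to G^{(0)}$; (E5) the moment map $s_Z:Z\to H^{(0)}$ is open and induces a homeomorphism $G\backslash Z\to H^{(0)}$. For $u\in G^{(0)}$ the isotropy group is $G(u)=\{\gamma\in G: r(\gamma)=u=s(\gamma)\}$.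 A subset $F\subset G^{(0)}$ is $G$-invariant if, for all $\gamma\in G$, $r(\gamma)\in F$ if and only if $s(\gamma)\in F$. $G$ is topologically principal if $\{u\in G^{(0)}: G(u)=\{u\}\}$ is dense in $G^{(0)}$. $G$ is essentially principal if for every closed $G$-invariant set $F\subset G^{(0)}$, the set $\{u\in F: G(u)=\{u\}\}$ is dense in $F$. *)

theory Defs
  imports "HOL-Analysis.Analysis"
begin

section \<open>Topological groupoids\<close>

record 'g gpd =
  gtop :: "'g topology"
  rng  :: "'g \<Rightarrow> 'g"
  src  :: "'g \<Rightarrow> 'g"
  gmul :: "'g \<Rightarrow> 'g \<Rightarrow> 'g"
  ginv :: "'g \<Rightarrow> 'g"

text \<open>The arrows of \<open>G\<close> are the points of \<open>gtop G\<close>; units are identified with their identity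
  arrows, and the unit space carries the relative topology. All operations are only meaningful on
  arrows, and \<open>gmul G \<gamma> \<eta>\<close> only for composable pairs, i.e. when \<open>src G \<gamma> = rng G \<eta>\<close>.\<close>

abbreviation arrows :: "'g gpd \<Rightarrow> 'g set" where
  "arrows G \<equiv> topspace (gtop G)"

definition units :: "'g gpd \<Rightarrow> 'g set" where
  "units G = rng G ` arrows G"

definition unit_space :: "'g gpd \<Rightarrow> 'g topology" where
  "unit_space G = subtopology (gtop G) (units G)"

definition composable :: "'g gpd \<Rightarrow> ('g \<times> 'g) set" where
  "composable G = {(\<gamma>, \<eta>). \<gamma> \<in> arrows G \<and> \<eta> \<in> arrows G \<and> src G \<gamma> = rng G \<eta>}"

definition groupoid :: "'g gpd \<Rightarrow> bool" where
  "groupoid G \<longleftrightarrow>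
     (\<forall>\<gamma>\<in>arrows G. rng G \<gamma> \<in> arrows G \<and> src G \<gamma> \<in> units G) \<and>
     (\<forall>u\<in>units G. rng G u = u \<and> src G u = u) \<and>
     (\<forall>(\<gamma>, \<eta>)\<in>composable G.
        gmul G \<gamma> \<eta> \<in> arrows G \<and> rng G (gmul G \<gamma> \<eta>) = rng G \<gamma> \<and> src G (gmul G \<gamma> \<eta>) = src G \<eta>) \<and>
     (\<forall>\<gamma> \<eta> \<xi>. (\<gamma>, \<eta>) \<in> composable G \<longrightarrow> (\<eta>, \<xi>) \<in> composable G \<longrightarrow>
        gmul G (gmul G \<gamma> \<eta>) \<xi> = gmul G \<gamma> (gmul G \<eta> \<xi>)) \<and>
     (\<forall>\<gamma>\<in>arrows G. gmul G (rng G \<gamma>) \<gamma> = \<gamma> \<and> gmul G \<gamma> (src G \<gamma>) = \<gamma>) \<and>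
     (\<forall>\<gamma>\<in>arrows G. ginv G \<gamma> \<in> arrows G \<and>
        rng G (ginv G \<gamma>) = src G \<gamma> \<and> src G (ginv G \<gamma>) = rng G \<gamma> \<and>
        gmul G \<gamma> (ginv G \<gamma>) = rng G \<gamma> \<and> gmul G (ginv G \<gamma>) \<gamma> = src G \<gamma>)"

text \<open>Continuity of \<open>r\<close> and \<open>s\<close> is automatic, since \<open>r(\<gamma>) = \<gamma>\<gamma>\<^sup>-\<^sup>1\<close> and \<open>s(\<gamma>) = \<gamma>\<^sup>-\<^sup>1\<gamma>\<close>.\<close>

definition topological_groupoid :: "'g gpd \<Rightarrow> bool" where
  "topological_groupoid G \<longleftrightarrow>
     groupoid G \<and>
     continuous_map (subtopology (prod_topology (gtop G) (gtop G)) (composable G)) (gtop G)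
       (\<lambda>(\<gamma>, \<eta>). gmul G \<gamma> \<eta>) \<and>
     continuous_map (gtop G) (gtop G) (ginv G)"

definition open_range_source :: "'g gpd \<Rightarrow> bool" where
  "open_range_source G \<longleftrightarrow>
     open_map (gtop G) (unit_space G) (rng G) \<and> open_map (gtop G) (unit_space G) (src G)"

definition isotropy :: "'g gpd \<Rightarrow> 'g \<Rightarrow> 'g set" where
  "isotropy G u = {\<gamma> \<in> arrows G. rng G \<gamma> = u \<and> src G \<gamma> = u}"

definition invariant_set :: "'g gpd \<Rightarrow> 'g set \<Rightarrow> bool" where
  "invariant_set G F \<longleftrightarrow>
     F \<subseteq> units G \<and> (\<forall>\<gamma>\<in>arrows G. rng G \<gamma> \<in> F \<longleftrightarrow> src G \<gamma> \<in> F)"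

definition dense_subset :: "'a topology \<Rightarrow> 'a set \<Rightarrow> bool" where
  "dense_subset X D \<longleftrightarrow> D \<subseteq> topspace X \<and> X closure_of D = topspace X"

definition topologically_principal :: "'g gpd \<Rightarrow> bool" where
  "topologically_principal G \<longleftrightarrow>
     dense_subset (unit_space G) {u \<in> units G. isotropy G u = {u}}"

definition essentially_principal :: "'g gpd \<Rightarrow> bool" where
  "essentially_principal G \<longleftrightarrow>
     (\<forall>F. closedin (unit_space G) F \<and> invariant_set G F \<longrightarrow>
        dense_subset (subtopology (unit_space G) F) {u \<in> F. isotropy G u = {u}})"


section \<open>Actions\<close>

text \<open>Properness in the sense of preimages of compact sets; the library's \<open>proper_map\<close> is the
  notion of a closed map with compact fibres.\<close>

definition compact_proper_map :: "'a topology \<Rightarrow> 'b topology \<Rightarrow> ('a \<Rightarrow> 'b) \<Rightarrow> bool" where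
  "compact_proper_map X Y f \<longleftrightarrow>
     continuous_map X Y f \<and> (\<forall>K. compactin Y K \<longrightarrow> compactin X {x \<in> topspace X. f x \<in> K})"

definition left_fibre_product :: "'g gpd \<Rightarrow> 'p topology \<Rightarrow> ('p \<Rightarrow> 'g) \<Rightarrow> ('g \<times> 'p) topology" where
  "left_fibre_product G P r\<^sub>P =
     subtopology (prod_topology (gtop G) P) {(\<gamma>, p). src G \<gamma> = r\<^sub>P p}"

definition left_action ::
    "'g gpd \<Rightarrow> 'p topology \<Rightarrow> ('p \<Rightarrow> 'g) \<Rightarrow> ('g \<Rightarrow> 'p \<Rightarrow> 'p) \<Rightarrow> bool" where
  "left_action G P r\<^sub>P act \<longleftrightarrow>
     continuous_map P (unit_space G) r\<^sub>P \<and>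
     continuous_map (left_fibre_product G P r\<^sub>P) P (\<lambda>(\<gamma>, p). act \<gamma> p) \<and>
     (\<forall>(\<gamma>, p)\<in>topspace (left_fibre_product G P r\<^sub>P). r\<^sub>P (act \<gamma> p) = rng G \<gamma>) \<and>
     (\<forall>p\<in>topspace P. act (r\<^sub>P p) p = p) \<and>
     (\<forall>\<gamma> \<eta> p. (\<gamma>, \<eta>) \<in> composable G \<longrightarrow> (\<eta>, p) \<in> topspace (left_fibre_product G P r\<^sub>P) \<longrightarrow>
        act \<gamma> (act \<eta> p) = act (gmul G \<gamma> \<eta>) p)"

definition left_free ::
    "'g gpd \<Rightarrow> 'p topology \<Rightarrow> ('p \<Rightarrow> 'g) \<Rightarrow> ('g \<Rightarrow> 'p \<Rightarrow> 'p) \<Rightarrow> bool" where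
  "left_free G P r\<^sub>P act \<longleftrightarrow>
     (\<forall>(\<gamma>, p)\<in>topspace (left_fibre_product G P r\<^sub>P). act \<gamma> p = p \<longrightarrow> \<gamma> = r\<^sub>P p)"

definition left_proper ::
    "'g gpd \<Rightarrow> 'p topology \<Rightarrow> ('p \<Rightarrow> 'g) \<Rightarrow> ('g \<Rightarrow> 'p \<Rightarrow> 'p) \<Rightarrow> bool" where
  "left_proper G P r\<^sub>P act \<longleftrightarrow>
     compact_proper_map (left_fibre_product G P r\<^sub>P) (prod_topology P P) (\<lambda>(\<gamma>, p). (act \<gamma> p, p))"

definition left_orbit ::
    "'g gpd \<Rightarrow> ('p \<Rightarrow> 'g) \<Rightarrow> ('g \<Rightarrow> 'p \<Rightarrow> 'p) \<Rightarrow> 'p \<Rightarrow> 'p set" where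
  "left_orbit G r\<^sub>P act p = {act \<gamma> p |\<gamma>. \<gamma> \<in> arrows G \<and> src G \<gamma> = r\<^sub>P p}"

definition right_fibre_product :: "'p topology \<Rightarrow> 'h gpd \<Rightarrow> ('p \<Rightarrow> 'h) \<Rightarrow> ('p \<times> 'h) topology" where
  "right_fibre_product P H s\<^sub>P =
     subtopology (prod_topology P (gtop H)) {(p, \<eta>). s\<^sub>P p = rng H \<eta>}"

definition right_action ::
    "'p topology \<Rightarrow> 'h gpd \<Rightarrow> ('p \<Rightarrow> 'h) \<Rightarrow> ('p \<Rightarrow> 'h \<Rightarrow> 'p) \<Rightarrow> bool" where
  "right_action P H s\<^sub>P act \<longleftrightarrow>
     continuous_map P (unit_space H) s\<^sub>P \<and>
     continuous_map (right_fibre_product P H s\<^sub>P) P (\<lambda>(p, \<eta>). act p \<eta>) \<and>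
     (\<forall>(p, \<eta>)\<in>topspace (right_fibre_product P H s\<^sub>P). s\<^sub>P (act p \<eta>) = src H \<eta>) \<and>
     (\<forall>p\<in>topspace P. act p (s\<^sub>P p) = p) \<and>
     (\<forall>p \<eta> \<xi>. (p, \<eta>) \<in> topspace (right_fibre_product P H s\<^sub>P) \<longrightarrow> (\<eta>, \<xi>) \<in> composable H \<longrightarrow>
        act (act p \<eta>) \<xi> = act p (gmul H \<eta> \<xi>))"

definition right_free ::
    "'p topology \<Rightarrow> 'h gpd \<Rightarrow> ('p \<Rightarrow> 'h) \<Rightarrow> ('p \<Rightarrow> 'h \<Rightarrow> 'p) \<Rightarrow> bool" where
  "right_free P H s\<^sub>P act \<longleftrightarrow>
     (\<forall>(p, \<eta>)\<in>topspace (right_fibre_product P H s\<^sub>P). act p \<eta> = p \<longrightarrow> \<eta> = s\<^sub>P p)"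

definition right_proper ::
    "'p topology \<Rightarrow> 'h gpd \<Rightarrow> ('p \<Rightarrow> 'h) \<Rightarrow> ('p \<Rightarrow> 'h \<Rightarrow> 'p) \<Rightarrow> bool" where
  "right_proper P H s\<^sub>P act \<longleftrightarrow>
     compact_proper_map (right_fibre_product P H s\<^sub>P) (prod_topology P P) (\<lambda>(p, \<eta>). (p, act p \<eta>))"

definition right_orbit ::
    "'h gpd \<Rightarrow> ('p \<Rightarrow> 'h) \<Rightarrow> ('p \<Rightarrow> 'h \<Rightarrow> 'p) \<Rightarrow> 'p \<Rightarrow> 'p set" where
  "right_orbit H s\<^sub>P act p = {act p \<eta> |\<eta>. \<eta> \<in> arrows H \<and> s\<^sub>P p = rng H \<eta>}"


section \<open>Orbit spaces\<close>

text \<open>The quotient topology on the image of \<open>q\<close>; applied below to the map sending a point to its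
  orbit, so that the points of an orbit space are orbits.\<close>

definition quotient_topology :: "'a topology \<Rightarrow> ('a \<Rightarrow> 'b) \<Rightarrow> 'b topology" where
  "quotient_topology X q =
     topology (\<lambda>V. V \<subseteq> q ` topspace X \<and> openin X {x \<in> topspace X. q x \<in> V})"

lemma openin_quotient_topology:
  "openin (quotient_topology X q) V \<longleftrightarrow>
     V \<subseteq> q ` topspace X \<and> openin X {x \<in> topspace X. q x \<in> V}"
proof -
  have "istopology (\<lambda>V. V \<subseteq> q ` topspace X \<and> openin X {x \<in> topspace X. q x \<in> V})"
    unfolding istopology_def
  proof (intro conjI allI impI)
    fix S T
    assume "S \<subseteq> q ` topspace X \<and> openin X {x \<in> topspace X. q x \<in> S}"
      and "T \<subseteq> q ` topspace X \<and> openin X {x \<in> topspace X. q x \<in> T}"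
    moreover have "{x \<in> topspace X. q x \<in> S \<inter> T} =
        {x \<in> topspace X. q x \<in> S} \<inter> {x \<in> topspace X. q x \<in> T}"
      by blast
    ultimately show "S \<inter> T \<subseteq> q ` topspace X" "openin X {x \<in> topspace X. q x \<in> S \<inter> T}"
      by (auto intro: openin_Int)
  next
    fix \<K>
    assume *: "\<forall>K\<in>\<K>. K \<subseteq> q ` topspace X \<and> openin X {x \<in> topspace X. q x \<in> K}"
    then show "\<Union>\<K> \<subseteq> q ` topspace X"
      by blast
    have "{x \<in> topspace X. q x \<in> \<Union>\<K>} = (\<Union>K\<in>\<K>. {x \<in> topspace X. q x \<in> K})"
      by blast
    with * show "openin X {x \<in> topspace X. q x \<in> \<Union>\<K>}"
      by auto
  qed
  then show ?thesis
    unfolding quotient_topology_def by (simp add: topology_inverse')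
qed

lemma topspace_quotient_topology [simp]:
  "topspace (quotient_topology X q) = q ` topspace X"
proof
  show "topspace (quotient_topology X q) \<subseteq> q ` topspace X"
    by (metis openin_quotient_topology openin_topspace)
  have "{x \<in> topspace X. q x \<in> q ` topspace X} = topspace X"
    by blast
  then have "openin (quotient_topology X q) (q ` topspace X)"
    by (simp add: openin_quotient_topology)
  then show "q ` topspace X \<subseteq> topspace (quotient_topology X q)"
    by (rule openin_subset)
qed

lemma quotient_map_quotient_topology: "quotient_map X (quotient_topology X q) q"
  by (auto simp: quotient_map_def openin_quotient_topology)

definition induces_homeomorphism ::
    "'a topology \<Rightarrow> ('a \<Rightarrow> 'b) \<Rightarrow> 'c topology \<Rightarrow> ('a \<Rightarrow> 'c) \<Rightarrow> bool" where
  "induces_homeomorphism X q Y f \<longleftrightarrow>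
     (\<exists>g. homeomorphic_map (quotient_topology X q) Y g \<and> (\<forall>x\<in>topspace X. g (q x) = f x))"


section \<open>Equivalence of groupoids\<close>

text \<open>In the clause on commuting actions, both \<open>\<gamma> \<cdot> (z \<cdot> \<eta>)\<close> and \<open>(\<gamma> \<cdot> z) \<cdot> \<eta>\<close> are defined
  because \<open>r\<^sub>Z\<close> and \<open>s\<^sub>Z\<close> factor through the orbit spaces for the opposite action, by the last two
  clauses.\<close>

definition groupoid_equivalence ::
    "'g gpd \<Rightarrow> 'h gpd \<Rightarrow> 'z topology \<Rightarrow> ('z \<Rightarrow> 'g) \<Rightarrow> ('g \<Rightarrow> 'z \<Rightarrow> 'z) \<Rightarrow>
     ('z \<Rightarrow> 'h) \<Rightarrow> ('z \<Rightarrow> 'h \<Rightarrow> 'z) \<Rightarrow> bool" where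
  "groupoid_equivalence G H Z r\<^sub>Z lact s\<^sub>Z ract \<longleftrightarrow>
     locally_compact_space Z \<and> Hausdorff_space Z \<and>
     (left_action G Z r\<^sub>Z lact \<and> left_free G Z r\<^sub>Z lact \<and> left_proper G Z r\<^sub>Z lact) \<and>
     (right_action Z H s\<^sub>Z ract \<and> right_free Z H s\<^sub>Z ract \<and> right_proper Z H s\<^sub>Z ract) \<and>
     (\<forall>\<gamma>\<in>arrows G. \<forall>z\<in>topspace Z. \<forall>\<eta>\<in>arrows H. src G \<gamma> = r\<^sub>Z z \<longrightarrow> s\<^sub>Z z = rng H \<eta> \<longrightarrow>
        lact \<gamma> (ract z \<eta>) = ract (lact \<gamma> z) \<eta>) \<and>
     (open_map Z (unit_space G) r\<^sub>Z \<and>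
      induces_homeomorphism Z (right_orbit H s\<^sub>Z ract) (unit_space G) r\<^sub>Z) \<and>
     (open_map Z (unit_space H) s\<^sub>Z \<and>
      induces_homeomorphism Z (left_orbit G r\<^sub>Z lact) (unit_space H) s\<^sub>Z)"

text \<open>The type argument is the type of points of the linking space, which cannot be quantified
  over inside a formula.\<close>

definition equivalent_groupoids :: "'z itself \<Rightarrow> 'g gpd \<Rightarrow> 'h gpd \<Rightarrow> bool" where
  "equivalent_groupoids TYPE('z) G H \<longleftrightarrow>
     (\<exists>(Z :: 'z topology) r\<^sub>Z lact s\<^sub>Z ract. groupoid_equivalence G H Z r\<^sub>Z lact s\<^sub>Z ract)"

end

theory Submission
  imports Defs
begin

text \<open>
  Write \<open>r\<close> and \<open>s\<close> for the moment maps of the linking space \<open>Z\<close>. Since the fibres of \<open>s\<close> are the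
  \<open>G\<close>-orbits and \<open>G\<close> acts freely, the isotropy of \<open>G\<close> at \<open>r z\<close> is trivial iff \<open>z\<close> is determined
  by the pair \<open>(r z, s z)\<close>. This criterion is symmetric in \<open>G\<close> and \<open>H\<close>. Likewise, the invariant
  sets on either side correspond to the subsets of \<open>Z\<close> that are saturated for both \<open>r\<close> and \<open>s\<close>.
  Closedness and density can be tested after pulling back along the open surjections \<open>r\<close> and \<open>s\<close>,
  so both properties become conditions on \<open>Z\<close>, \<open>r\<close> and \<open>s\<close> alone.
\<close>

section \<open>Density in a subspace and its pullback along open surjections\<close>

lemma dense_subset_subtopology_iff:
  assumes "A \<subseteq> F" "F \<subseteq> topspace X"
  shows "dense_subset (subtopology X F) A \<longleftrightarrow>
    (\<forall>U. openin X U \<longrightarrow> U \<inter> F \<noteq> {} \<longrightarrow> A \<inter> U \<noteq> {})"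
proof -
  \<comment> \<open>Open sets of the subspace are the traces \<open>U \<inter> F\<close>; as
    \<open>A \<subseteq> F\<close>, such a trace meets \<open>A\<close> exactly where
    \<open>U\<close> does, so density can be tested on open sets of \<open>X\<close>.\<close>
  have "A \<inter> (U \<inter> F) = A \<inter> U" for U
    using assms(1) by blast
  then have "(\<forall>T. openin (subtopology X F) T \<and> T \<noteq> {} \<longrightarrow> A \<inter> T \<noteq> {}) \<longleftrightarrow>
      (\<forall>U. openin X U \<longrightarrow> U \<inter> F \<noteq> {} \<longrightarrow> A \<inter> U \<noteq> {})"
    unfolding openin_subtopology by metis
  moreover have "A \<subseteq> topspace (subtopology X F)"
    using assms by auto
  ultimately show ?thesis
    unfolding dense_subset_def dense_intersects_open by blast
qed

text \<open>An open set of \<open>Z\<close> that meets the preimage of \<open>F\<close> has an open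
  image meeting \<open>F\<close>. Conversely, continuity makes preimages of open sets open, and
  surjectivity keeps their trace on the preimage of \<open>F\<close> nonempty.\<close>

lemma dense_subset_subtopology_preimage:
  assumes cont: "continuous_map Z X f" and op: "open_map Z X f"
    and surj: "f ` topspace Z = topspace X" and "A \<subseteq> F" "F \<subseteq> topspace X"
  shows "dense_subset (subtopology X F) A \<longleftrightarrow>
    dense_subset (subtopology Z {z \<in> topspace Z. f z \<in> F}) {z \<in> topspace Z. f z \<in> A}"
    (is "_ \<longleftrightarrow> dense_subset (subtopology Z ?F) ?A")
proof -
  have "dense_subset (subtopology X F) A \<longleftrightarrow>
      (\<forall>U. openin X U \<longrightarrow> U \<inter> F \<noteq> {} \<longrightarrow> A \<inter> U \<noteq> {})"
    using assms(4,5) by (rule dense_subset_subtopology_iff)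
  also have "\<dots> \<longleftrightarrow> (\<forall>V. openin Z V \<longrightarrow> V \<inter> ?F \<noteq> {} \<longrightarrow> ?A \<inter> V \<noteq> {})"
  proof (intro iffI allI impI)
    fix V
    assume dense: "\<forall>U. openin X U \<longrightarrow> U \<inter> F \<noteq> {} \<longrightarrow> A \<inter> U \<noteq> {}"
      and V: "openin Z V" "V \<inter> ?F \<noteq> {}"
    have "openin X (f ` V)"
      using op V(1) by (simp add: open_map_def)
    with dense V(2) have "A \<inter> f ` V \<noteq> {}"
      by blast
    then show "?A \<inter> V \<noteq> {}"
      using openin_subset[OF V(1)] by blast
  next
    fix U
    assume dense: "\<forall>V. openin Z V \<longrightarrow> V \<inter> ?F \<noteq> {} \<longrightarrow> ?A \<inter> V \<noteq> {}"
      and U: "openin X U" "U \<inter> F \<noteq> {}"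
    have "openin Z {z \<in> topspace Z. f z \<in> U}"
      using cont U(1) by (rule openin_continuous_map_preimage)
    moreover have "{z \<in> topspace Z. f z \<in> U} \<inter> ?F \<noteq> {}"
    proof -
      from U(2) obtain x where "x \<in> U" "x \<in> F"
        by blast
      moreover from this surj assms(5) obtain z where "z \<in> topspace Z" "f z = x"
        by (metis (no_types, lifting) imageE subsetD)
      ultimately show ?thesis
        by blast
    qed
    ultimately show "A \<inter> U \<noteq> {}"
      using dense by blast
  qed
  also have "\<dots> \<longleftrightarrow> dense_subset (subtopology Z ?F) ?A"
    by (rule dense_subset_subtopology_iff[symmetric]) (use assms(4) in auto)
  finally show ?thesis .
qed

section \<open>Unit spaces and the opposite groupoid\<close>

lemma rng_in_units: "\<gamma> \<in> arrows G \<Longrightarrow> rng G \<gamma> \<in> units G"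
  by (simp add: units_def)

lemma units_subset_arrows: "groupoid G \<Longrightarrow> units G \<subseteq> arrows G"
  by (auto simp: groupoid_def units_def)

lemma topspace_unit_space: "groupoid G \<Longrightarrow> topspace (unit_space G) = units G"
  using units_subset_arrows by (auto simp: unit_space_def)

lemma subtopology_unit_space: "groupoid G \<Longrightarrow> subtopology (unit_space G) (units G) = unit_space G"
  by (metis subtopology_topspace topspace_unit_space)

text \<open>A right action of a groupoid is a left action of its opposite, so orbits, isotropy and
  invariance need to be studied for left actions only.\<close>

definition opposite_gpd :: "'g gpd \<Rightarrow> 'g gpd" where
  "opposite_gpd G = G\<lparr>rng := src G, src := rng G, gmul := (\<lambda>\<gamma> \<eta>. gmul G \<eta> \<gamma>)\<rparr>"

lemma opposite_gpd_simps [simp]: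
  "gtop (opposite_gpd G) = gtop G" "rng (opposite_gpd G) = src G" "src (opposite_gpd G) = rng G"
  "gmul (opposite_gpd G) \<gamma> \<eta> = gmul G \<eta> \<gamma>" "ginv (opposite_gpd G) = ginv G"
  by (simp_all add: opposite_gpd_def)

text \<open>Reversal replaces the image of \<open>rng\<close> by that of \<open>src\<close>; the two
  agree because every source is a unit and every unit is its own source.\<close>

lemma units_opposite_gpd:
  assumes "groupoid G"
  shows "units (opposite_gpd G) = units G"
proof
  show "units (opposite_gpd G) \<subseteq> units G"
    using assms by (auto simp: units_def[of "opposite_gpd G"] groupoid_def)
  show "units G \<subseteq> units (opposite_gpd G)"
  proof
    fix u assume "u \<in> units G"
    then have "u = src G u" "u \<in> arrows G"
      using assms units_subset_arrows by (auto simp: groupoid_def)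
    then show "u \<in> units (opposite_gpd G)"
      using rng_in_units[of u "opposite_gpd G"] by simp
  qed
qed

lemma groupoid_opposite_gpd:
  assumes "groupoid G"
  shows "groupoid (opposite_gpd G)"
proof -
  have comp: "(\<gamma>, \<eta>) \<in> composable (opposite_gpd G) \<longleftrightarrow> (\<eta>, \<gamma>) \<in> composable G" for \<gamma> \<eta>
    by (auto simp: composable_def)
  have "src G \<gamma> \<in> arrows G" "rng G \<gamma> \<in> units G" if "\<gamma> \<in> arrows G" for \<gamma>
    using assms that units_subset_arrows[OF assms] rng_in_units[OF that] by (auto simp: groupoid_def)
  moreover have "gmul G \<xi> (gmul G \<eta> \<gamma>) = gmul G (gmul G \<xi> \<eta>) \<gamma>"
    if "(\<eta>, \<gamma>) \<in> composable G" "(\<xi>, \<eta>) \<in> composable G" for \<gamma> \<eta> \<xi>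
    using assms that unfolding groupoid_def by metis
  moreover have "\<forall>(\<gamma>, \<eta>)\<in>composable (opposite_gpd G). gmul G \<eta> \<gamma> \<in> arrows G \<and>
      src G (gmul G \<eta> \<gamma>) = src G \<gamma> \<and> rng G (gmul G \<eta> \<gamma>) = rng G \<eta>"
    using assms comp unfolding groupoid_def by fast
  moreover have "\<forall>u\<in>units G. src G u = u \<and> rng G u = u"
    and "\<forall>\<gamma>\<in>arrows G. gmul G \<gamma> (src G \<gamma>) = \<gamma> \<and> gmul G (rng G \<gamma>) \<gamma> = \<gamma>"
    and "\<forall>\<gamma>\<in>arrows G. ginv G \<gamma> \<in> arrows G \<and>
      src G (ginv G \<gamma>) = rng G \<gamma> \<and> rng G (ginv G \<gamma>) = src G \<gamma> \<and>
      gmul G (ginv G \<gamma>) \<gamma> = src G \<gamma> \<and> gmul G \<gamma> (ginv G \<gamma>) = rng G \<gamma>"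
    using assms unfolding groupoid_def by blast+
  ultimately show ?thesis
    unfolding groupoid_def units_opposite_gpd[OF assms]
    by (intro conjI allI impI) (simp_all add: comp)
qed

lemma isotropy_opposite_gpd: "isotropy (opposite_gpd G) u = isotropy G u"
  by (auto simp: isotropy_def)

lemma invariant_set_opposite_gpd:
  "groupoid G \<Longrightarrow> invariant_set (opposite_gpd G) F \<longleftrightarrow> invariant_set G F"
  by (auto simp: invariant_set_def units_opposite_gpd)

section \<open>Orbits, isotropy and invariant sets of a left action, without topology\<close>

locale gpd_action =
  fixes G :: "'g gpd" and Z :: "'z set" and m :: "'z \<Rightarrow> 'g" and act :: "'g \<Rightarrow> 'z \<Rightarrow> 'z"
  assumes groupoid: "groupoid G"
    and moment_in_units: "z \<in> Z \<Longrightarrow> m z \<in> units G"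
    and act_closed: "\<gamma> \<in> arrows G \<Longrightarrow> z \<in> Z \<Longrightarrow> src G \<gamma> = m z \<Longrightarrow> act \<gamma> z \<in> Z"
    and moment_act: "\<gamma> \<in> arrows G \<Longrightarrow> z \<in> Z \<Longrightarrow> src G \<gamma> = m z \<Longrightarrow> m (act \<gamma> z) = rng G \<gamma>"
    and act_moment: "z \<in> Z \<Longrightarrow> act (m z) z = z"
    and act_act: "\<gamma> \<in> arrows G \<Longrightarrow> \<eta> \<in> arrows G \<Longrightarrow> z \<in> Z \<Longrightarrow> src G \<gamma> = rng G \<eta> \<Longrightarrow>
      src G \<eta> = m z \<Longrightarrow> act \<gamma> (act \<eta> z) = act (gmul G \<gamma> \<eta>) z"
begin

lemma moment_unit:
  assumes "z \<in> Z"
  shows "m z \<in> arrows G" "rng G (m z) = m z" "src G (m z) = m z"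
  using groupoid moment_in_units[OF assms] units_subset_arrows[OF groupoid]
  by (auto simp: groupoid_def)

lemma left_orbit_act_subset:
  assumes "\<gamma> \<in> arrows G" "z \<in> Z" "src G \<gamma> = m z"
  shows "left_orbit G m act (act \<gamma> z) \<subseteq> left_orbit G m act z"
proof
  fix w assume "w \<in> left_orbit G m act (act \<gamma> z)"
  then obtain \<delta> where \<delta>: "\<delta> \<in> arrows G" "src G \<delta> = rng G \<gamma>" "w = act \<delta> (act \<gamma> z)"
    by (auto simp: left_orbit_def moment_act[OF assms])
  then have "(\<delta>, \<gamma>) \<in> composable G"
    using assms by (simp add: composable_def)
  then have "gmul G \<delta> \<gamma> \<in> arrows G" "src G (gmul G \<delta> \<gamma>) = m z"
    using groupoid assms by (auto simp: groupoid_def)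
  moreover have "w = act (gmul G \<delta> \<gamma>) z"
    using \<delta> assms act_act by simp
  ultimately show "w \<in> left_orbit G m act z"
    by (auto simp: left_orbit_def)
qed

text \<open>The arrow \<open>ginv G \<gamma>\<close> moves \<open>act \<gamma> z\<close> back to
  \<open>z\<close>, so the inclusion already proved also applies with the two points
  exchanged.\<close>

lemma left_orbit_act:
  assumes "\<gamma> \<in> arrows G" "z \<in> Z" "src G \<gamma> = m z"
  shows "left_orbit G m act (act \<gamma> z) = left_orbit G m act z"
proof
  have inv: "ginv G \<gamma> \<in> arrows G" "src G (ginv G \<gamma>) = rng G \<gamma>" "gmul G (ginv G \<gamma>) \<gamma> = m z"
    using groupoid assms by (auto simp: groupoid_def)
  then have "act (ginv G \<gamma>) (act \<gamma> z) = z"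
    using assms act_act act_moment by simp
  then show "left_orbit G m act z \<subseteq> left_orbit G m act (act \<gamma> z)"
    using left_orbit_act_subset[of "ginv G \<gamma>" "act \<gamma> z"] inv assms
    by (simp add: act_closed moment_act)
qed (rule left_orbit_act_subset[OF assms])

text \<open>Each point lies in its own orbit, through the unit at its moment; hence equal orbits
  provide an arrow from \<open>z\<close> to \<open>z'\<close>. The converse is
  \<open>left_orbit_act\<close>.\<close>

lemma left_orbit_eq_iff:
  assumes "z \<in> Z" "z' \<in> Z"
  shows "left_orbit G m act z = left_orbit G m act z' \<longleftrightarrow>
    (\<exists>\<gamma>\<in>arrows G. src G \<gamma> = m z \<and> z' = act \<gamma> z)"
proof
  assume eq: "left_orbit G m act z = left_orbit G m act z'"
  have "z' \<in> left_orbit G m act z'"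
    using moment_unit[OF assms(2)] act_moment[OF assms(2)] unfolding left_orbit_def by force
  then show "\<exists>\<gamma>\<in>arrows G. src G \<gamma> = m z \<and> z' = act \<gamma> z"
    unfolding eq[symmetric] by (auto simp: left_orbit_def)
next
  assume "\<exists>\<gamma>\<in>arrows G. src G \<gamma> = m z \<and> z' = act \<gamma> z"
  then show "left_orbit G m act z = left_orbit G m act z'"
    using left_orbit_act assms(1) by force
qed

text \<open>The map \<open>t\<close> plays the role of the moment map for the other groupoid. The
  assumption on its fibres is the injectivity of the map that it induces on the orbit space.\<close>

context
  fixes t :: "'z \<Rightarrow> 'b"
  assumes fibres: "\<And>z z'. z \<in> Z \<Longrightarrow> z' \<in> Z \<Longrightarrow>
    t z = t z' \<longleftrightarrow> left_orbit G m act z = left_orbit G m act z'"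
begin

lemma fibre_act:
  assumes "\<gamma> \<in> arrows G" "z \<in> Z" "src G \<gamma> = m z"
  shows "t (act \<gamma> z) = t z"
  using fibres[of "act \<gamma> z" z] left_orbit_act[OF assms] act_closed[OF assms] assms(2) by simp

lemma fibre_obtains:
  assumes "z \<in> Z" "z' \<in> Z" "t z = t z'"
  obtains \<gamma> where "\<gamma> \<in> arrows G" "src G \<gamma> = m z" "rng G \<gamma> = m z'" "z' = act \<gamma> z"
  using assms fibres left_orbit_eq_iff moment_act by metis

text \<open>The map \<open>\<gamma> \<mapsto> act \<gamma> z\<close> sends the isotropy group at
  \<open>m z\<close> onto the set of points that agree with \<open>z\<close> under both
  \<open>m\<close> and \<open>t\<close>. If the group is trivial, this set is therefore
  \<open>{z}\<close>; if the set is \<open>{z}\<close>, every isotropy arrow fixes \<open>z\<close>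
  and freeness makes it a unit.\<close>

lemma isotropy_trivial_iff:
  assumes "z \<in> Z"
    and free: "\<And>\<gamma>. \<gamma> \<in> arrows G \<Longrightarrow> src G \<gamma> = m z \<Longrightarrow> act \<gamma> z = z \<Longrightarrow> \<gamma> = m z"
  shows "isotropy G (m z) = {m z} \<longleftrightarrow> (\<forall>z'\<in>Z. m z' = m z \<and> t z' = t z \<longrightarrow> z' = z)"
proof
  assume trivial: "isotropy G (m z) = {m z}"
  show "\<forall>z'\<in>Z. m z' = m z \<and> t z' = t z \<longrightarrow> z' = z"
  proof (intro ballI impI)
    fix z' assume z': "z' \<in> Z" "m z' = m z \<and> t z' = t z"
    then obtain \<gamma> where \<gamma>: "\<gamma> \<in> arrows G" "src G \<gamma> = m z" "rng G \<gamma> = m z'" "z' = act \<gamma> z"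
      using fibre_obtains[of z z'] assms(1) by metis
    then have "\<gamma> \<in> isotropy G (m z)"
      using z' by (simp add: isotropy_def)
    then show "z' = z"
      using trivial \<gamma>(4) act_moment assms(1) by simp
  qed
next
  assume determined: "\<forall>z'\<in>Z. m z' = m z \<and> t z' = t z \<longrightarrow> z' = z"
  have "\<gamma> = m z" if "\<gamma> \<in> isotropy G (m z)" for \<gamma>
  proof -
    have \<gamma>: "\<gamma> \<in> arrows G" "rng G \<gamma> = m z" "src G \<gamma> = m z"
      using that by (auto simp: isotropy_def)
    then have "act \<gamma> z = z"
      using determined act_closed moment_act fibre_act assms(1) by simp
    then show ?thesis
      using free \<gamma> by simp
  qed
  moreover have "m z \<in> isotropy G (m z)"
    using moment_unit[OF assms(1)] by (simp add: isotropy_def)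
  ultimately show "isotropy G (m z) = {m z}"
    by blast
qed

text \<open>Surjectivity of \<open>m\<close> provides a point \<open>z\<close> over the source of
  any arrow \<open>\<gamma>\<close>; then \<open>src G \<gamma>\<close> and
  \<open>rng G \<gamma>\<close> are the moments of \<open>z\<close> and
  \<open>act \<gamma> z\<close>, which lie in one fibre of \<open>t\<close>. Conversely, two points
  in one fibre of \<open>t\<close> are joined by an arrow.\<close>

lemma invariant_set_iff:
  assumes "m ` Z = units G"
  shows "invariant_set G F \<longleftrightarrow>
    F \<subseteq> units G \<and> (\<forall>z\<in>Z. \<forall>z'\<in>Z. t z = t z' \<longrightarrow> (m z \<in> F \<longleftrightarrow> m z' \<in> F))"
proof -
  have "(\<forall>\<gamma>\<in>arrows G. rng G \<gamma> \<in> F \<longleftrightarrow> src G \<gamma> \<in> F) \<longleftrightarrow>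
      (\<forall>z\<in>Z. \<forall>z'\<in>Z. t z = t z' \<longrightarrow> (m z \<in> F \<longleftrightarrow> m z' \<in> F))" (is "?L \<longleftrightarrow> ?R")
  proof
    assume ?L
    then show ?R
      by (metis fibre_obtains)
  next
    assume ?R
    show ?L
    proof
      fix \<gamma> assume \<gamma>: "\<gamma> \<in> arrows G"
      then have "src G \<gamma> \<in> m ` Z"
        using groupoid assms by (simp add: groupoid_def)
      then obtain z where z: "z \<in> Z" "src G \<gamma> = m z"
        by blast
      then show "rng G \<gamma> \<in> F \<longleftrightarrow> src G \<gamma> \<in> F"
        using \<open>?R\<close> \<gamma> act_closed fibre_act moment_act by metis
    qed
  qed
  then show ?thesis
    by (simp add: invariant_set_def)
qed

end

end

section \<open>Algebraic content of continuous actions and of orbit space homeomorphisms\<close>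

lemma gpd_action_left:
  assumes "groupoid G" "left_action G P m act"
  shows "gpd_action G (topspace P) m act"
proof
  have m_continuous: "continuous_map P (unit_space G) m"
    and act_continuous: "continuous_map (left_fibre_product G P m) P (\<lambda>(\<gamma>, p). act \<gamma> p)"
    using assms(2) by (simp_all add: left_action_def)
  show "groupoid G"
    by fact
  \<comment> \<open>That moments are units and that translates stay in \<open>P\<close> is contained
    in continuity, since a continuous map sends the carrier of its domain into that of its
    codomain.\<close>
  show "m z \<in> units G" if "z \<in> topspace P" for z
    using continuous_map_image_subset_topspace[OF m_continuous] that assms(1)
    by (auto simp: topspace_unit_space)
  show "act \<gamma> z \<in> topspace P" if "\<gamma> \<in> arrows G" "z \<in> topspace P" "src G \<gamma> = m z" for \<gamma> z
    using continuous_map_image_subset_topspace[OF act_continuous] that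
    by (force simp: left_fibre_product_def)
qed (use assms(2) in \<open>auto simp: left_action_def left_fibre_product_def composable_def\<close>)

text \<open>Writing the arrow first turns
  \<open>(p \<cdot> \<eta>) \<cdot> \<xi> = p \<cdot> (\<eta>\<xi>)\<close> into the associativity
  law of a left action of the opposite, where the product of \<open>\<xi>\<close> and
  \<open>\<eta>\<close> is \<open>gmul H \<eta> \<xi>\<close>.\<close>

lemma gpd_action_right:
  assumes "groupoid H" "right_action P H m act"
  shows "gpd_action (opposite_gpd H) (topspace P) m (\<lambda>\<eta> p. act p \<eta>)"
proof
  have m_continuous: "continuous_map P (unit_space H) m"
    and act_continuous: "continuous_map (right_fibre_product P H m) P (\<lambda>(p, \<eta>). act p \<eta>)"
    using assms(2) by (simp_all add: right_action_def)
  show "groupoid (opposite_gpd H)"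
    using assms(1) by (rule groupoid_opposite_gpd)
  show "m z \<in> units (opposite_gpd H)" if "z \<in> topspace P" for z
    using continuous_map_image_subset_topspace[OF m_continuous] that assms(1)
    by (auto simp: topspace_unit_space units_opposite_gpd)
  show "act z \<eta> \<in> topspace P"
    if "\<eta> \<in> arrows (opposite_gpd H)" "z \<in> topspace P" "src (opposite_gpd H) \<eta> = m z" for \<eta> z
    using continuous_map_image_subset_topspace[OF act_continuous] that
    by (force simp: right_fibre_product_def)
qed (use assms(2) in \<open>auto simp: right_action_def right_fibre_product_def composable_def\<close>)

lemma right_orbit_eq_left_orbit:
  "right_orbit H m act = left_orbit (opposite_gpd H) m (\<lambda>\<eta> p. act p \<eta>)"
  by (auto simp: fun_eq_iff right_orbit_def left_orbit_def)

text \<open>On the carrier, \<open>f\<close> is \<open>q\<close> followed by a homeomorphism, which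
  is injective on the orbit space; so \<open>f\<close> and \<open>q\<close> have the same
  fibres.\<close>

lemma induces_homeomorphism_eq_iff:
  assumes "induces_homeomorphism X q Y f" "x \<in> topspace X" "x' \<in> topspace X"
  shows "f x = f x' \<longleftrightarrow> q x = q x'"
proof -
  obtain g where g: "homeomorphic_map (quotient_topology X q) Y g" "\<forall>x\<in>topspace X. g (q x) = f x"
    using assms(1) by (auto simp: induces_homeomorphism_def)
  then have "inj_on g (q ` topspace X)"
    using homeomorphic_imp_injective_map by fastforce
  then show ?thesis
    using g(2) assms(2,3) by (metis image_eqI inj_onD)
qed

lemma induces_homeomorphism_image:
  assumes "induces_homeomorphism X q Y f"
  shows "f ` topspace X = topspace Y"
proof -
  obtain g where g: "homeomorphic_map (quotient_topology X q) Y g" "\<forall>x\<in>topspace X. g (q x) = f x"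
    using assms by (auto simp: induces_homeomorphism_def)
  then have "g ` q ` topspace X = topspace Y"
    using homeomorphic_imp_surjective_map by fastforce
  then show ?thesis
    using g(2) by (simp add: image_image)
qed

section \<open>Transfer of both properties along a pair of open surjections\<close>

locale gpd_span =
  fixes G :: "'g gpd" and H :: "'h gpd" and Z :: "'z topology" and r :: "'z \<Rightarrow> 'g" and s :: "'z \<Rightarrow> 'h"
  assumes groupoids: "groupoid G" "groupoid H"
    and r_continuous: "continuous_map Z (unit_space G) r" and r_open: "open_map Z (unit_space G) r"
    and r_surj: "r ` topspace Z = units G"
    and s_continuous: "continuous_map Z (unit_space H) s" and s_open: "open_map Z (unit_space H) s"
    and s_surj: "s ` topspace Z = units H"
    and isotropy_iff: "z \<in> topspace Z \<Longrightarrow> isotropy G (r z) = {r z} \<longleftrightarrow> isotropy H (s z) = {s z}"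
    and invariant_left: "invariant_set G F \<longleftrightarrow> F \<subseteq> units G \<and>
      (\<forall>z\<in>topspace Z. \<forall>z'\<in>topspace Z. s z = s z' \<longrightarrow> (r z \<in> F \<longleftrightarrow> r z' \<in> F))"
    and invariant_right: "invariant_set H E \<longleftrightarrow> E \<subseteq> units H \<and>
      (\<forall>z\<in>topspace Z. \<forall>z'\<in>topspace Z. r z = r z' \<longrightarrow> (s z \<in> E \<longleftrightarrow> s z' \<in> E))"
begin

text \<open>The locale keeps of an equivalence only conditions on the two moment maps, and each has
  its mirror image among them. One implication in the essentially principal case thus yields the
  other.\<close>

lemma flip: "gpd_span H G Z s r"
  by (rule gpd_span.intro)
    (rule groupoids r_continuous r_open r_surj s_continuous s_open s_surj
      isotropy_iff[symmetric] invariant_left invariant_right | assumption)+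

text \<open>By \<open>FE\<close> the sets \<open>F\<close> and \<open>E\<close> have the same
  preimage in \<open>Z\<close>, and by \<open>isotropy_iff\<close> so do their subsets of points
  with trivial isotropy. Pulled back to \<open>Z\<close>, the two density statements
  coincide.\<close>

lemma dense_trivial_isotropy_iff:
  assumes "F \<subseteq> units G" "E \<subseteq> units H"
    and FE: "\<And>z. z \<in> topspace Z \<Longrightarrow> r z \<in> F \<longleftrightarrow> s z \<in> E"
  shows "dense_subset (subtopology (unit_space G) F) {u \<in> F. isotropy G u = {u}} \<longleftrightarrow>
    dense_subset (subtopology (unit_space H) E) {v \<in> E. isotropy H v = {v}}"
proof -
  have "{z \<in> topspace Z. r z \<in> F} = {z \<in> topspace Z. s z \<in> E}"
    "{z \<in> topspace Z. r z \<in> {u \<in> F. isotropy G u = {u}}} =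
     {z \<in> topspace Z. s z \<in> {v \<in> E. isotropy H v = {v}}}"
    using FE isotropy_iff by auto
  then show ?thesis
    using dense_subset_subtopology_preimage[OF r_continuous r_open, of "{u \<in> F. isotropy G u = {u}}" F]
      dense_subset_subtopology_preimage[OF s_continuous s_open, of "{v \<in> E. isotropy H v = {v}}" E]
      assms(1,2) groupoids r_surj s_surj
    by (simp add: topspace_unit_space)
qed

lemma topologically_principal_iff: "topologically_principal G \<longleftrightarrow> topologically_principal H"
proof -
  \<comment> \<open>Take all units on both sides: each preimage is the whole of
    \<open>Z\<close>.\<close>
  have "r z \<in> units G \<longleftrightarrow> s z \<in> units H" if "z \<in> topspace Z" for z
    using r_surj s_surj that by blast
  then show ?thesis
    using dense_trivial_isotropy_iff[of "units G" "units H"] groupoids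
    unfolding topologically_principal_def by (simp add: subtopology_unit_space)
qed

lemma essentially_principal_imp:
  assumes "essentially_principal G"
  shows "essentially_principal H"
  unfolding essentially_principal_def
proof (intro allI impI, elim conjE)
  fix E assume E: "closedin (unit_space H) E" "invariant_set H E"
  \<comment> \<open>Transport \<open>E\<close> to \<open>G\<close> through \<open>Z\<close>.
    Invariance of \<open>E\<close> says that its preimage under \<open>s\<close> is a union of
    fibres of \<open>r\<close>, so taking the image under \<open>r\<close> and pulling back gives
    the same subset of \<open>Z\<close>.\<close>
  define F where "F = r ` {z \<in> topspace Z. s z \<in> E}"
  have FE: "r z \<in> F \<longleftrightarrow> s z \<in> E" if "z \<in> topspace Z" for z
    using E(2)[unfolded invariant_right] that unfolding F_def by blast
  have "F \<subseteq> units G"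
    using r_surj by (auto simp: F_def)
  \<comment> \<open>For a quotient map, closedness of \<open>F\<close> can be checked on its
    preimage, which is the closed preimage of \<open>E\<close>.\<close>
  have "quotient_map Z (unit_space G) r"
    using r_continuous r_open r_surj groupoids
    by (simp add: continuous_open_imp_quotient_map topspace_unit_space)
  moreover have "{z \<in> topspace Z. r z \<in> F} = {z \<in> topspace Z. s z \<in> E}"
    using FE by blast
  moreover have "closedin Z {z \<in> topspace Z. s z \<in> E}"
    using s_continuous E(1) by (rule closedin_continuous_map_preimage)
  ultimately have "closedin (unit_space G) F"
    using \<open>F \<subseteq> units G\<close> topspace_unit_space[OF groupoids(1)]
    unfolding quotient_map_closedin by metis
  \<comment> \<open>Membership of \<open>r z\<close> in \<open>F\<close> depends on
    \<open>s z\<close> alone, which is invariance in the form of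
    \<open>invariant_left\<close>.\<close>
  moreover have "invariant_set G F"
    using \<open>F \<subseteq> units G\<close> FE unfolding invariant_left by metis
  ultimately show "dense_subset (subtopology (unit_space H) E) {v \<in> E. isotropy H v = {v}}"
    using assms dense_trivial_isotropy_iff[of F E] FE \<open>F \<subseteq> units G\<close> E(2)
    unfolding essentially_principal_def invariant_right by blast
qed

lemma essentially_principal_iff: "essentially_principal G \<longleftrightarrow> essentially_principal H"
  using essentially_principal_imp gpd_span.essentially_principal_imp[OF flip] by blast

end

section \<open>From an equivalence to the pair of moment maps\<close>

lemma gpd_span_groupoid_equivalence:
  assumes "groupoid G" "groupoid H" "groupoid_equivalence G H Z r lact s ract"
  shows "gpd_span G H Z r s"
proof -
  let ?H = "opposite_gpd H" and ?act = "\<lambda>\<eta> z. ract z \<eta>"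
  have left: "left_action G Z r lact" "left_free G Z r lact"
    and right: "right_action Z H s ract" "right_free Z H s ract"
    and "open": "open_map Z (unit_space G) r" "open_map Z (unit_space H) s"
    and homeo: "induces_homeomorphism Z (left_orbit ?H s ?act) (unit_space G) r"
      "induces_homeomorphism Z (left_orbit G r lact) (unit_space H) s"
    using assms(3) by (simp_all add: groupoid_equivalence_def right_orbit_eq_left_orbit)
  interpret L: gpd_action G "topspace Z" r lact
    using assms(1) left(1) by (rule gpd_action_left)
  interpret R: gpd_action ?H "topspace Z" s ?act
    using assms(2) right(1) by (rule gpd_action_right)
  \<comment> \<open>The roles cross: the fibres of \<open>s\<close> are the \<open>G\<close>-orbits
    and those of \<open>r\<close> are the \<open>H\<close>-orbits.\<close>
  note L_fibres = induces_homeomorphism_eq_iff[OF homeo(2)]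
  note R_fibres = induces_homeomorphism_eq_iff[OF homeo(1)]
  have surj: "r ` topspace Z = units G" "s ` topspace Z = units H"
    using homeo[THEN induces_homeomorphism_image] assms(1,2) by (simp_all add: topspace_unit_space)
  show ?thesis
  proof
    fix z assume z: "z \<in> topspace Z"
    have "isotropy G (r z) = {r z} \<longleftrightarrow>
        (\<forall>z'\<in>topspace Z. r z' = r z \<and> s z' = s z \<longrightarrow> z' = z)"
      by (rule L.isotropy_trivial_iff[OF L_fibres z])
        (use left(2) z in \<open>auto simp: left_free_def left_fibre_product_def\<close>)
    \<comment> \<open>The criterion is symmetric in \<open>r\<close> and \<open>s\<close>, so it can
      now be read for the action of \<open>H\<close>, whose opposite has the same isotropy
      groups.\<close>
    also have "\<dots> \<longleftrightarrow> (\<forall>z'\<in>topspace Z. s z' = s z \<and> r z' = r z \<longrightarrow> z' = z)"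
      by blast
    also have "\<dots> \<longleftrightarrow> isotropy ?H (s z) = {s z}"
      by (rule R.isotropy_trivial_iff[OF R_fibres z, symmetric])
        (use right(2) z in \<open>auto simp: right_free_def right_fibre_product_def\<close>)
    finally show "isotropy G (r z) = {r z} \<longleftrightarrow> isotropy H (s z) = {s z}"
      by (simp add: isotropy_opposite_gpd)
  next
    show "invariant_set G F \<longleftrightarrow> F \<subseteq> units G \<and>
      (\<forall>z\<in>topspace Z. \<forall>z'\<in>topspace Z. s z = s z' \<longrightarrow> (r z \<in> F \<longleftrightarrow> r z' \<in> F))" for F
      using L_fibres surj(1) by (rule L.invariant_set_iff)
    show "invariant_set H E \<longleftrightarrow> E \<subseteq> units H \<and>
      (\<forall>z\<in>topspace Z. \<forall>z'\<in>topspace Z. r z = r z' \<longrightarrow> (s z \<in> E \<longleftrightarrow> s z' \<in> E))" for E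
      using R.invariant_set_iff[OF R_fibres, unfolded units_opposite_gpd[OF assms(2)], OF _ _ surj(2)]
      unfolding invariant_set_opposite_gpd[OF assms(2)] .
  qed (use assms(1,2) left(1) right(1) "open" surj in
      \<open>simp_all add: left_action_def right_action_def\<close>)
qed

theorem theorem3p4:
  fixes G :: "'g gpd" and H :: "'h gpd"
  assumes "topological_groupoid G" and "locally_compact_space (gtop G)"
    and "Hausdorff_space (gtop G)" and "open_range_source G"
    and "topological_groupoid H" and "locally_compact_space (gtop H)"
    and "Hausdorff_space (gtop H)" and "open_range_source H"
    and "equivalent_groupoids TYPE('z) G H"
  shows "(topologically_principal G \<longleftrightarrow> topologically_principal H) \<and>
         (essentially_principal G \<longleftrightarrow> essentially_principal H)"
proof -
  have "groupoid G" "groupoid H"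
    using assms(1,5) by (simp_all add: topological_groupoid_def)
  moreover obtain Z :: "'z topology" and r lact s ract
    where "groupoid_equivalence G H Z r lact s ract"
    using assms(9) by (auto simp: equivalent_groupoids_def)
  ultimately have "gpd_span G H Z r s"
    by (rule gpd_span_groupoid_equivalence)
  then show ?thesis
    using gpd_span.topologically_principal_iff gpd_span.essentially_principal_iff by blast
qed

end
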